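(* Let $k\ge 3$ and $d\ge 1$ be integers, let $G$ be a $d$-regular (ordinary, finite simple) graph, and let $\mathcal{G}=G^{k}$ be the $k$th power of $G$. Then $$\rho(\mathcal{G})=\frac{k-3+d+\sqrt{(k-3+d)^{2}+4d(k-1)}}{2(k-1)}.$$
   Context: A hypergraph $\mathcal{G}=(V,E)$ consists of a finite nonempty vertex set $V$ and a set $E$ of edges, each edge being a subset of $V$ with at least two elements (edges are pairwise distinct, undirected). It is $k$-uniform if every edge has exactly $k$ elements; an ordinary graph is a 2-uniform hypergraph. A graph is $d$-regular if every vertex has degree $d$. Adjacency matrix: $\mathcal{A}_{\mathcal{G}}$ is the real symmetric matrix indexed by $V$ with $(\mathcal{A}_{\mathcal{G}})_{ij}=\sum_{e\in E,\ i,j\in e}\frac{1}{|e|-1}$ for $i\ne j$, and zero diagonal. The spectral radius $\rho(\mathcal{G})$ is the maximum modulus of the eigenvalues of $\mathcal{A}_{\mathcal{G}}$. For an ordinary graph $G=(V,E)$ and $k\ge 3$, the $k$th power $G^{k}$ is the $k$-uniform hypergraph obtained by adding to each edge $e\in E$ a set of $k-2$ new vertices $v_{e_1},\dots,v_{e_{k-2}}$: its edge set is $\{e\cup\{v_{e_1},\dots,v_{e_{k-2}}\}: e\in E\}$ and its vertex set is $V\cup\bigcup_{e\in E}\{v_{e_1},\dots,v_{e_{k-2}}\}$, where the added sets are disjoint from $V$ and from each other for distinct edges. *)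

theory Defs
  imports "Jordan_Normal_Form.Spectral_Radius" "HOL-Library.Countable_Set"
begin

record 'a hypergraph =
  verts :: "'a set"
  edges :: "'a set set"

definition is_hypergraph :: "'a hypergraph \<Rightarrow> bool" where
  "is_hypergraph H \<longleftrightarrow> finite (verts H) \<and> verts H \<noteq> {} \<and>
     (\<forall>e \<in> edges H. e \<subseteq> verts H \<and> 2 \<le> card e)"

definition is_uniform :: "nat \<Rightarrow> 'a hypergraph \<Rightarrow> bool" where
  "is_uniform k H \<longleftrightarrow> (\<forall>e \<in> edges H. card e = k)"

definition is_graph :: "'a hypergraph \<Rightarrow> bool" where
  "is_graph G \<longleftrightarrow> is_hypergraph G \<and> is_uniform 2 G"

definition vertex_degree :: "'a hypergraph \<Rightarrow> 'a \<Rightarrow> nat" where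
  "vertex_degree H v = card {e \<in> edges H. v \<in> e}"

definition is_regular :: "nat \<Rightarrow> 'a hypergraph \<Rightarrow> bool" where
  "is_regular d H \<longleftrightarrow> (\<forall>v \<in> verts H. vertex_degree H v = d)"

definition adjacency :: "'a hypergraph \<Rightarrow> 'a \<Rightarrow> 'a \<Rightarrow> real" where
  "adjacency H u v =
     (if u = v then 0 else \<Sum>e | e \<in> edges H \<and> u \<in> e \<and> v \<in> e. 1 / (real (card e) - 1))"

(* Matrices are indexed by {0..<n} and not by the vertex set, so the vertices are enumerated
   by from_nat_into, which is a bijection from {..<card (verts H)} onto verts H as verts H is
   finite.  By adjacency_matrix_eigenvalue_iff the eigenvalues do not depend on this
   enumeration. *)
definition adjacency_matrix :: "'a hypergraph \<Rightarrow> real mat" where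
  "adjacency_matrix H =
     mat (card (verts H)) (card (verts H))
       (\<lambda>(i, j). adjacency H (from_nat_into (verts H) i) (from_nat_into (verts H) j))"

definition hypergraph_spectral_radius :: "'a hypergraph \<Rightarrow> real" where
  "hypergraph_spectral_radius H =
     spectral_radius (map_mat complex_of_real (adjacency_matrix H))"

(* The vertices of G are the Inl v; the k - 2 vertices added to the edge e are the Inr (e, i)
   with i < k - 2. *)
definition new_verts :: "nat \<Rightarrow> 'a set \<Rightarrow> ('a + 'a set \<times> nat) set" where
  "new_verts k e = (\<lambda>i. Inr (e, i)) ` {..<k - 2}"

definition power_hypergraph :: "nat \<Rightarrow> 'a hypergraph \<Rightarrow> ('a + 'a set \<times> nat) hypergraph" where
  "power_hypergraph k G =
     \<lparr> verts = Inl ` verts G \<union> (\<Union>e \<in> edges G. new_verts k e),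
       edges = (\<lambda>e. Inl ` e \<union> new_verts k e) ` edges G \<rparr>"

lemma power_hypergraph_wf:
  assumes "is_graph G" and "2 \<le> k"
  shows "is_hypergraph (power_hypergraph k G)" and "is_uniform k (power_hypergraph k G)"
proof -
  have G: "finite (verts G)" "verts G \<noteq> {}" "\<And>e. e \<in> edges G \<Longrightarrow> e \<subseteq> verts G \<and> card e = 2"
    using assms by (auto simp: is_graph_def is_hypergraph_def is_uniform_def)
  have fin_edges: "finite (edges G)"
    by (rule finite_subset[of _ "Pow (verts G)"]) (use G in auto)
  have card_edge: "card (Inl ` e \<union> new_verts k e) = k" if "e \<in> edges G" for e
  proof -
    have "finite e" using that G by (meson finite_subset)
    then have "card (Inl ` e \<union> new_verts k e) = card e + (k - 2)"
      by (subst card_Un_disjoint) (auto simp: new_verts_def card_image inj_on_def)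
    then show ?thesis using that G assms by auto
  qed
  show "is_uniform k (power_hypergraph k G)"
    using card_edge by (auto simp: is_uniform_def power_hypergraph_def)
  then show "is_hypergraph (power_hypergraph k G)"
    using G fin_edges assms
    by (fastforce simp: is_hypergraph_def is_uniform_def power_hypergraph_def new_verts_def)
qed

lemma adjacency_matrix_eigenvalue_iff:
  fixes H :: "'a hypergraph" and l :: complex
  assumes fin: "finite (verts H)"
  shows "eigenvalue (map_mat complex_of_real (adjacency_matrix H)) l \<longleftrightarrow>
    (\<exists>x. (\<exists>v \<in> verts H. x v \<noteq> 0) \<and>
       (\<forall>u \<in> verts H. (\<Sum>v \<in> verts H. complex_of_real (adjacency H u v) * x v) = l * x u))"
    (is "?L \<longleftrightarrow> ?R")
proof -
  define n where "n = card (verts H)"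
  define f where "f = from_nat_into (verts H)"
  define M where "M = map_mat complex_of_real (adjacency_matrix H)"
  have bij: "bij_betw f {..<n} (verts H)"
    unfolding f_def n_def by (rule bij_betw_from_nat_into_finite[OF fin])
  have M: "M \<in> carrier_mat n n" "dim_row M = n"
    by (auto simp: M_def adjacency_matrix_def n_def)
  have img: "f ` {..<n} = verts H" using bij by (simp add: bij_betw_def)
  have sum_eq: "(\<Sum>v \<in> verts H. g v) = (\<Sum>j<n. g (f j))" for g :: "'a \<Rightarrow> complex"
    using sum.reindex_bij_betw[OF bij, of g] by simp
  have mult: "(M *\<^sub>v w) $ i = (\<Sum>j<n. complex_of_real (adjacency H (f i) (f j)) * w $ j)"
    if "w \<in> carrier_vec n" "i < n" for w i
    using that
    by (auto simp: M_def adjacency_matrix_def n_def f_def scalar_prod_def atLeast0LessThan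
        intro!: sum.cong)
  show ?thesis unfolding M_def[symmetric]
  proof
    assume "eigenvalue M l"
    then obtain w where w: "w \<in> carrier_vec n" "w \<noteq> 0\<^sub>v n" "M *\<^sub>v w = l \<cdot>\<^sub>v w"
      unfolding eigenvalue_def eigenvector_def using M by auto
    define x where "x v = w $ the_inv_into {..<n} f v" for v
    have xf: "x (f i) = w $ i" if "i < n" for i
      using that bij by (simp add: x_def the_inv_into_f_f bij_betw_def)
    obtain i where i: "i < n" "w $ i \<noteq> 0"
      using w(1,2) by (metis carrier_vecD eq_vecI index_zero_vec(1,2))
    have "\<exists>v \<in> verts H. x v \<noteq> 0" by (metis i xf img imageI lessThan_iff)
    moreover have "\<forall>u \<in> verts H. (\<Sum>v \<in> verts H. complex_of_real (adjacency H u v) * x v) = l * x u"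
    proof
      fix u assume "u \<in> verts H"
      then obtain i where i: "i < n" "u = f i" using img by auto
      have "(M *\<^sub>v w) $ i = l * w $ i" using w i by simp
      then show "(\<Sum>v \<in> verts H. complex_of_real (adjacency H u v) * x v) = l * x u"
        using mult[OF w(1) i(1)] i xf by (simp add: sum_eq)
    qed
    ultimately show ?R by blast
  next
    assume ?R
    then obtain x where x: "\<exists>v \<in> verts H. x v \<noteq> 0"
      "\<And>u. u \<in> verts H \<Longrightarrow> (\<Sum>v \<in> verts H. complex_of_real (adjacency H u v) * x v) = l * x u"
      by blast
    define w where "w = vec n (\<lambda>i. x (f i))"
    have w: "w \<in> carrier_vec n" by (simp add: w_def)
    obtain i where i: "i < n" "x (f i) \<noteq> 0" using x(1) img by (metis imageE lessThan_iff)
    have "w \<noteq> 0\<^sub>v n" using i by (metis index_vec index_zero_vec(1) w_def)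
    moreover have "M *\<^sub>v w = l \<cdot>\<^sub>v w"
    proof (rule eq_vecI)
      fix i assume "i < dim_vec (l \<cdot>\<^sub>v w)"
      then have i: "i < n" by (simp add: w_def)
      then have "f i \<in> verts H" using img by auto
      from x(2)[OF this] show "(M *\<^sub>v w) $ i = (l \<cdot>\<^sub>v w) $ i"
        using mult[OF w i] i by (simp add: sum_eq w_def)
    qed (use M in \<open>simp add: w_def\<close>)
    ultimately show "eigenvalue M l"
      unfolding eigenvalue_def eigenvector_def using w M by auto
  qed
qed

end

theory Submission
  imports Defs
begin

text \<open>A positive eigenvector of a nonnegative matrix belongs to the spectral radius.  For the power
of a regular graph such an eigenvector can be written down: by symmetry it may be taken constant,
with value \<open>a\<close>, on the vertices of \<open>G\<close>, and constant, with value \<open>b\<close>, on the added vertices.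
Every edge then has total weight \<open>2 a + (k - 2) b\<close>, a vertex of \<open>G\<close> lies in \<open>d\<close> edges and an added
vertex in exactly one, so with \<open>m = (k - 1) \<rho>\<close> the eigenvalue equations become
  \<open>m a = d (a + (k - 2) b)\<close> and \<open>m b = 2 a + (k - 3) b\<close>.
The second one is solved by \<open>a = m - (k - 3)\<close>, \<open>b = 2\<close>; the first one is then the quadratic equation
\<open>m\<^sup>2 = (k - 3 + d) m + d (k - 1)\<close>.  Its larger root exceeds \<open>k - 3\<close>, which makes \<open>a\<close> positive.

That a positive eigenvector determines the spectral radius is
\<open>spectral_radius_eq_of_positive_eigenvector\<close>; the eigenvalue equations are obtained from
\<open>adjacency_sum_uniform\<close>, which needs only the weight of an edge and the number of edges at a
vertex.\<close>

text \<open>If \<open>x\<close> is the positive eigenvector and \<open>y\<close> any complex one, the eigenvalue equation of \<open>y\<close>, read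
at a vertex where \<open>cmod y / x\<close> is largest, bounds the modulus of its eigenvalue by \<open>r\<close>.\<close>

lemma spectral_radius_eq_of_positive_eigenvector:
  fixes H :: "'a hypergraph" and x :: "'a \<Rightarrow> real"
  assumes H: "is_hypergraph H"
    and pos: "\<And>v. v \<in> verts H \<Longrightarrow> 0 < x v"
    and eig: "\<And>u. u \<in> verts H \<Longrightarrow> (\<Sum>v \<in> verts H. adjacency H u v * x v) = r * x u"
  shows "hypergraph_spectral_radius H = r"
proof -
  define M where "M = map_mat complex_of_real (adjacency_matrix H)"
  have fin: "finite (verts H)" and ne: "verts H \<noteq> {}"
    using H by (auto simp: is_hypergraph_def)
  have M: "M \<in> carrier_mat (card (verts H)) (card (verts H))"
    by (simp add: M_def adjacency_matrix_def)
  have n: "0 < card (verts H)" using fin ne by (simp add: card_gt_0_iff)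
  have adj_nonneg: "0 \<le> adjacency H u v" for u v
    using H by (force simp: adjacency_def is_hypergraph_def intro!: sum_nonneg)
  obtain v0 where v0: "v0 \<in> verts H" using ne by auto
  have "0 \<le> r * x v0"
    unfolding eig[OF v0, symmetric]
    by (intro sum_nonneg mult_nonneg_nonneg adj_nonneg less_imp_le pos)
  then have r0: "0 \<le> r" using pos[OF v0] by (simp add: zero_le_mult_iff)
  have "eigenvalue M (complex_of_real r)"
    unfolding M_def adjacency_matrix_eigenvalue_iff[OF fin]
  proof (intro exI[of _ "\<lambda>v. complex_of_real (x v)"] conjI ballI)
    show "\<exists>v \<in> verts H. complex_of_real (x v) \<noteq> 0"
      using v0 pos[OF v0] by (intro bexI[of _ v0]) auto
    fix u assume "u \<in> verts H"
    then show "(\<Sum>v \<in> verts H. complex_of_real (adjacency H u v) * complex_of_real (x v))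
        = complex_of_real r * complex_of_real (x u)"
      using eig by (simp flip: of_real_mult of_real_sum)
  qed
  then have "cmod (complex_of_real r) \<in> cmod ` spectrum M"
    unfolding spectrum_def by blast
  from spectral_radius_mem_max(2)[OF M n this] have lower: "r \<le> spectral_radius M"
    using r0 by simp
  have upper: "cmod l \<le> r" if "eigenvalue M l" for l
  proof -
    from that[unfolded M_def adjacency_matrix_eigenvalue_iff[OF fin]]
    obtain y where y: "(\<exists>v \<in> verts H. y v \<noteq> 0) \<and>
      (\<forall>u \<in> verts H. (\<Sum>v \<in> verts H. complex_of_real (adjacency H u v) * y v) = l * y u)" ..
    define q where "q v = cmod (y v) / x v" for v
    have "Max (q ` verts H) \<in> q ` verts H"
      by (rule Max_in) (use fin ne in auto)
    then obtain u where u: "u \<in> verts H" and qu_Max: "Max (q ` verts H) = q u" by blast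
    have umax: "q v \<le> q u" if "v \<in> verts H" for v
      using Max_ge[of "q ` verts H" "q v"] fin that by (simp add: qu_Max)
    have y_le: "cmod (y v) \<le> q u * x v" if "v \<in> verts H" for v
      using umax[OF that] pos[OF that] by (simp add: q_def[of v] pos_divide_le_eq)
    obtain w where "w \<in> verts H" "y w \<noteq> 0" using y by blast
    then have "0 < q w" using pos by (simp add: q_def)
    then have qu: "0 < q u" using umax[OF \<open>w \<in> verts H\<close>] by linarith
    have yu: "cmod (y u) = q u * x u" using pos[OF u] by (simp add: q_def)
    have "cmod l * cmod (y u) = cmod (\<Sum>v \<in> verts H. complex_of_real (adjacency H u v) * y v)"
      using y u by (simp add: norm_mult)
    also have "\<dots> \<le> (\<Sum>v \<in> verts H. adjacency H u v * (q u * x v))"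
      by (intro sum_norm_le) (simp add: norm_mult adj_nonneg mult_left_mono y_le)
    also have "\<dots> = q u * (\<Sum>v \<in> verts H. adjacency H u v * x v)"
      by (simp add: sum_distrib_left mult_ac)
    also have "\<dots> = r * cmod (y u)" by (simp add: eig[OF u] yu)
    finally show "cmod l \<le> r" using qu pos[OF u] by (simp add: yu)
  qed
  obtain l where "eigenvalue M l" "spectral_radius M = cmod l"
    using spectral_radius_mem_max(1)[OF M n] unfolding spectrum_def by blast
  then have "spectral_radius M \<le> r" using upper by simp
  with lower show ?thesis
    unfolding hypergraph_spectral_radius_def M_def[symmetric] by simp
qed

text \<open>Exchanging the sums over vertices and edges makes the adjacency matrix act edge by edge.\<close>

lemma adjacency_sum_uniform:
  fixes H :: "'a hypergraph" and x :: "'a \<Rightarrow> real"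
  assumes H: "is_hypergraph H" and unif: "is_uniform k H" and u: "u \<in> verts H"
  shows "(\<Sum>v \<in> verts H. adjacency H u v * x v)
    = (\<Sum>e | e \<in> edges H \<and> u \<in> e. (\<Sum>v \<in> e. x v) - x u) / (real k - 1)"
proof -
  define E where "E = {e \<in> edges H. u \<in> e}"
  have fin: "finite (verts H)" and sub: "\<And>e. e \<in> edges H \<Longrightarrow> e \<subseteq> verts H"
    using H by (auto simp: is_hypergraph_def)
  have finE: "finite E"
    by (rule finite_subset[of _ "Pow (verts H)"]) (use fin sub in \<open>auto simp: E_def\<close>)
  have adj: "adjacency H u v * x v
      = (\<Sum>e \<in> E. if v \<in> e - {u} then x v / (real k - 1) else 0)" for v
  proof (cases "u = v")
    case False
    have "adjacency H u v = (\<Sum>e | e \<in> E \<and> v \<in> e. 1 / (real k - 1))"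
      using False unif by (auto simp: adjacency_def E_def is_uniform_def intro!: sum.cong)
    then have "adjacency H u v * x v = (\<Sum>e | e \<in> E \<and> v \<in> e. x v / (real k - 1))"
      by simp
    also have "\<dots> = (\<Sum>e \<in> E. if v \<in> e then x v / (real k - 1) else 0)"
      using finE by (simp only: sum.inter_filter)
    finally have "adjacency H u v * x v
        = (\<Sum>e \<in> E. if v \<in> e then x v / (real k - 1) else 0)" .
    moreover have "v \<in> e - {u} \<longleftrightarrow> v \<in> e" for e using False by auto
    ultimately show ?thesis by (simp only:)
  qed (simp add: adjacency_def)
  have edge: "(\<Sum>v \<in> verts H. if v \<in> e - {u} then x v / (real k - 1) else 0)
      = ((\<Sum>v \<in> e. x v) - x u) / (real k - 1)" if "e \<in> E" for e
  proof -
    have e: "e \<subseteq> verts H" "u \<in> e" using that sub by (auto simp: E_def)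
    have "{v \<in> verts H. v \<in> e - {u}} = e - {u}" using e by auto
    then have "(\<Sum>v \<in> verts H. if v \<in> e - {u} then x v / (real k - 1) else 0)
        = (\<Sum>v \<in> e - {u}. x v / (real k - 1))"
      by (simp only: sum.inter_filter[OF fin, symmetric])
    also have "\<dots> = ((\<Sum>v \<in> e. x v) - x u) / (real k - 1)"
      using e finite_subset[OF e(1) fin] by (simp add: sum_diff1 flip: sum_divide_distrib)
    finally show ?thesis .
  qed
  have "(\<Sum>v \<in> verts H. adjacency H u v * x v)
      = (\<Sum>e \<in> E. \<Sum>v \<in> verts H. if v \<in> e - {u} then x v / (real k - 1) else 0)"
    unfolding adj by (rule sum.swap)
  also have "\<dots> = (\<Sum>e \<in> E. (\<Sum>v \<in> e. x v) - x u) / (real k - 1)"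
    using edge by (simp add: sum_divide_distrib)
  finally show ?thesis by (simp add: E_def)
qed

lemma power_edge_sum:
  fixes e :: "'a set" and a b :: real
  assumes "finite e"
  shows "(\<Sum>w \<in> Inl ` e \<union> new_verts k e. case_sum (\<lambda>_. a) (\<lambda>_. b) w)
    = real (card e) * a + real (k - 2) * b"
proof -
  let ?x = "case_sum (\<lambda>_. a) (\<lambda>_. b) :: 'a + 'a set \<times> nat \<Rightarrow> real"
  have "sum ?x (Inl ` e \<union> new_verts k e) = sum ?x (Inl ` e) + sum ?x (new_verts k e)"
    by (rule sum.union_disjoint) (use assms in \<open>auto simp: new_verts_def\<close>)
  also have "sum ?x (Inl ` e) = real (card e) * a"
    by (subst sum.reindex) auto
  also have "sum ?x (new_verts k e) = real (k - 2) * b"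
    unfolding new_verts_def by (subst sum.reindex) (auto simp: inj_on_def)
  finally show ?thesis .
qed

lemma card_power_edges_at_old_vertex:
  "card {f \<in> edges (power_hypergraph k G). Inl v \<in> f} = vertex_degree G v"
proof -
  let ?ext = "\<lambda>e. Inl ` e \<union> new_verts k e :: ('a + 'a set \<times> nat) set"
  have "{f \<in> edges (power_hypergraph k G). Inl v \<in> f} = ?ext ` {e \<in> edges G. v \<in> e}"
    by (auto simp: power_hypergraph_def new_verts_def)
  moreover have "inj ?ext"
    by (rule inj_on_inverseI[of _ "\<lambda>f. Inl -` f"]) (auto simp: new_verts_def)
  ultimately show ?thesis
    by (simp add: vertex_degree_def card_image inj_on_subset[OF _ subset_UNIV])
qed

lemma power_edges_at_new_vertex:
  assumes "e \<in> edges G" and "i < k - 2"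
  shows "{f \<in> edges (power_hypergraph k G). Inr (e, i) \<in> f} = {Inl ` e \<union> new_verts k e}"
  using assms by (auto simp: power_hypergraph_def new_verts_def)

theorem theorem1p1:
  fixes G :: "'a hypergraph" and k d :: nat
  assumes "k \<ge> 3" and "d \<ge> 1"
    and "is_graph G" and "is_regular d G"
  shows "hypergraph_spectral_radius (power_hypergraph k G) =
    (real k - 3 + real d + sqrt ((real k - 3 + real d)\<^sup>2 + 4 * real d * (real k - 1)))
      / (2 * (real k - 1))"
proof -
  define P where "P = power_hypergraph k G"
  define s where "s = real k - 3 + real d"
  define D where "D = s\<^sup>2 + 4 * real d * (real k - 1)"
  define m where "m = (s + sqrt D) / 2"
  define a where "a = m - (real k - 3)"
  define x :: "'a + 'a set \<times> nat \<Rightarrow> real" where "x = case_sum (\<lambda>_. a) (\<lambda>_. 2)"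
  have k: "real k \<ge> 3" and d: "real d \<ge> 1" using assms by auto
  have k2: "real (k - 2) = real k - 2" using assms(1) by (simp add: of_nat_diff)
  have P: "is_hypergraph P" "is_uniform k P"
    using power_hypergraph_wf[of G k] assms by (auto simp: P_def)
  have e2: "finite e" "card e = 2" if "e \<in> edges G" for e
    using assms(3) that by (auto simp: is_graph_def is_hypergraph_def is_uniform_def
        intro: card_ge_0_finite)
  have D0: "0 \<le> D" using k d by (simp add: D_def)
  have m_eq: "m\<^sup>2 = s * m + real d * (real k - 1)"
    using D0 by (simp add: m_def power2_sum power_divide field_simps)
      (simp add: D_def algebra_simps power2_eq_square)
  have "real k - 3 < m"
  proof -
    \<comment> \<open>The discriminant exceeds \<open>(k - 3 - d)\<^sup>2\<close> by \<open>8 d (k - 2)\<close>.\<close>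
    have "0 < real d * (real k - 2)" using k d by simp
    then have "(real k - 3 - real d)\<^sup>2 < D"
      unfolding D_def s_def by (simp add: power2_eq_square algebra_simps)
    then have "real k - 3 - real d < sqrt D" by (rule real_less_rsqrt)
    then show ?thesis by (simp add: m_def s_def)
  qed
  then have a0: "0 < a" by (simp add: a_def)
  have edge_sum: "(\<Sum>w \<in> f. x w) = 2 * a + 2 * (real k - 2)" if "f \<in> edges P" for f
  proof -
    obtain e where e: "e \<in> edges G" "f = Inl ` e \<union> new_verts k e"
      using \<open>f \<in> edges P\<close> by (auto simp: P_def power_hypergraph_def)
    show ?thesis
      using power_edge_sum[OF e2(1)[OF e(1)], where k = k and a = a and b = 2] e2(2)[OF e(1)] k2
      by (simp add: x_def e(2))
  qed
  have eig: "(\<Sum>v \<in> verts P. adjacency P u v * x v) = m / (real k - 1) * x u"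
    if u: "u \<in> verts P" for u
  proof -
    have sum_eq: "(\<Sum>v \<in> verts P. adjacency P u v * x v)
        = real (card {f \<in> edges P. u \<in> f}) * (2 * a + 2 * (real k - 2) - x u) / (real k - 1)"
      by (simp add: adjacency_sum_uniform[OF P u] edge_sum)
    have "real (card {f \<in> edges P. u \<in> f}) * (2 * a + 2 * (real k - 2) - x u) = m * x u"
    proof (cases u)
      case (Inl v)
      then have "v \<in> verts G" using u by (auto simp: P_def power_hypergraph_def new_verts_def)
      then have "card {f \<in> edges P. u \<in> f} = d"
        using assms(4) card_power_edges_at_old_vertex[of k G v]
        by (simp add: is_regular_def P_def Inl)
      moreover have "real d * (a + 2 * (real k - 2)) = m * a"
        using m_eq by (simp add: a_def s_def power2_eq_square algebra_simps)
      ultimately show ?thesis by (simp add: x_def Inl)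
    next
      case (Inr p)
      then obtain e i where "p = (e, i)" "e \<in> edges G" "i < k - 2"
        using u by (auto simp: P_def power_hypergraph_def new_verts_def)
      then have "card {f \<in> edges P. u \<in> f} = 1"
        using power_edges_at_new_vertex[of e G i k] by (simp add: P_def Inr)
      then show ?thesis by (simp add: x_def Inr a_def)
    qed
    then show ?thesis by (simp add: sum_eq)
  qed
  have "hypergraph_spectral_radius P = m / (real k - 1)"
    by (rule spectral_radius_eq_of_positive_eigenvector[OF P(1) _ eig])
      (auto simp: x_def a0 split: sum.split)
  then show ?thesis by (simp add: P_def m_def D_def s_def)
qed

end
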